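(* Let $G=(V,E)$ be a graph with $|V|=n$. Then $$\vartheta(G)=z^{\mathcal{C}}_{0}(G)=z^{\mathcal{C}}_{1}(G)\geqslant z^{\mathcal{C}}_{k-1}(G)\geqslant z^{\mathcal{C}}_{k}(G)\geqslant z^{\mathcal{C}}_{n}(G)=\alpha(G)$$ holds for all $k\in\{1,\dots,n\}$.
   Context: Graphs are finite, simple and undirected, with vertex set $V=\{1,\dots,n\}$, $n\geqslant 1$. $\alpha(G)$ is the stability number (maximum cardinality of a set of pairwise non-adjacent vertices). $\mathcal{S}_n$ denotes the set of real symmetric $n\times n$ matrices, $\mathbf{1}_n$ the all-ones vector, $\mathbf{1}_{n\times n}$ the all-ones matrix, $\langle X,Y\rangle=\sum_{i,j}X_{i,j}Y_{i,j}$, and $X\succcurlyeq 0$ means positive semidefinite. For a graph $H$, the set of stable set vectors is $\mathcal{S}(H)=\{s\in\{0,1\}^{V(H)} : s_is_j=0 \text{ for all } \{i,j\}\in E(H)\}$, and the squared stable set polytope is $\operatorname{STAB}^2(H)=\operatorname{conv}\{ss^T : s\in\mathcal{S}(H)\}$. For $I\subseteq V$, $G_I$ is the subgraph of $G$ induced by $I$, and for an $n\times n$ matrix $X$, $X_I=(X_{i,j})_{i,j\in I}$. For $I=\emptyset$ the constraint $X_I\in\operatorname{STAB}^2(G_I)$ is vacuous. Define $$\operatorname{CTH}^2(G)=\{X\in\mathcal{S}_n : \operatorname{trace}(X)=1,\ X_{i,j}=0\ \forall\{i,j\}\in E,\ X\succcurlyeq 0\}.$$ The Lovász theta function is $\vartheta(G)=\max\{\langle\mathbf{1}_{n\times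 n},X\rangle : X\in\operatorname{CTH}^2(G)\}$; by a known result it also equals $\max\{\mathbf{1}_n^Tx : (x,X)\in\mathbb{R}^n\times\mathcal{S}_n,\ \operatorname{diag}(X)=x,\ X_{i,j}=0\ \forall\{i,j\}\in E,\ X-xx^T\succcurlyeq 0\}$. For an integer $0\leqslant k\leqslant n$, the $k$-th level of the compressed exact subgraph hierarchy is $$z^{\mathcal{C}}_{k}(G)=\max\{\langle\mathbf{1}_{n\times n},X\rangle : X\in\operatorname{CTH}^2(G),\ X_I\in\operatorname{STAB}^2(G_I)\ \forall I\subseteq V \text{ with } |I|=k\}.$$ *)

theory Defs
  imports "HOL-Analysis.Analysis"
begin

text \<open>
  A graph is given by a vertex set \<open>V\<close> and a set \<open>E\<close> of edges, each edge being a two-element subset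
  of \<open>V\<close>. The ambient graph has vertex set \<open>UNIV :: 'n set\<close>, so that its order is \<open>CARD('n)\<close> and
  real symmetric matrices indexed by its vertices live in \<open>real ^ 'n ^ 'n\<close>.
\<close>

definition simple_graph :: "'a set \<Rightarrow> 'a set set \<Rightarrow> bool" where
  "simple_graph V E \<longleftrightarrow> finite V \<and> (\<forall>e\<in>E. e \<subseteq> V \<and> card e = 2)"

definition induced_edges :: "'a set set \<Rightarrow> 'a set \<Rightarrow> 'a set set" where
  "induced_edges E I = {e \<in> E. e \<subseteq> I}"

definition stable_sets :: "'a set \<Rightarrow> 'a set set \<Rightarrow> 'a set set" where
  "stable_sets V E = {S. S \<subseteq> V \<and> pairwise (\<lambda>i j. {i, j} \<notin> E) S}"

definition stability_number :: "'a set \<Rightarrow> 'a set set \<Rightarrow> nat" where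
  "stability_number V E = Max (card ` stable_sets V E)"

text \<open>
  Vectors in \<open>\<real>\<^sup>I\<close> and \<open>I \<times> I\<close> matrices, for \<open>I \<subseteq> UNIV\<close>, are represented by their extension by zero
  to \<open>real ^ 'n\<close> and \<open>real ^ 'n ^ 'n\<close>. This is a linear embedding, so it commutes with convex hulls.
\<close>

definition stable_set_vectors :: "'n set \<Rightarrow> 'n set set \<Rightarrow> (real ^ 'n::finite) set" where
  "stable_set_vectors V E =
     {s. (\<forall>i\<in>V. s $ i \<in> {0, 1}) \<and> (\<forall>i. i \<notin> V \<longrightarrow> s $ i = 0) \<and>
         (\<forall>i j. {i, j} \<in> E \<longrightarrow> s $ i * s $ j = 0)}"

definition outer_square :: "real ^ 'n \<Rightarrow> real ^ 'n ^ 'n::finite" where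
  "outer_square s = (\<chi> i j. s $ i * s $ j)"

definition STAB2 :: "'n set \<Rightarrow> 'n set set \<Rightarrow> (real ^ 'n ^ 'n::finite) set" where
  "STAB2 V E = convex hull (outer_square ` stable_set_vectors V E)"

definition submatrix_on :: "'n set \<Rightarrow> real ^ 'n ^ 'n \<Rightarrow> real ^ 'n ^ 'n::finite" where
  "submatrix_on I X = (\<chi> i j. if i \<in> I \<and> j \<in> I then X $ i $ j else 0)"

definition symmetric_matrices :: "(real ^ 'n ^ 'n::finite) set" where
  "symmetric_matrices = {X. transpose X = X}"

definition psd :: "real ^ 'n ^ 'n::finite \<Rightarrow> bool" where
  "psd X \<longleftrightarrow> X \<in> symmetric_matrices \<and> (\<forall>v. 0 \<le> v \<bullet> (X *v v))"

definition ones_matrix :: "real ^ 'n ^ 'n::finite" where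
  "ones_matrix = (\<chi> i j. 1)"

definition CTH2 :: "'n set set \<Rightarrow> (real ^ 'n ^ 'n::finite) set" where
  "CTH2 E = {X \<in> symmetric_matrices. trace X = 1 \<and> (\<forall>i j. {i, j} \<in> E \<longrightarrow> X $ i $ j = 0) \<and> psd X}"

text \<open>
  Since \<open>X \<bullet> Y\<close> on \<open>real ^ 'n ^ 'n\<close> is the sum of the entrywise products, it is the trace inner
  product. The maxima are taken over infinite sets, hence \<open>GREATEST\<close>; they are attained by
  \<open>lovasz_theta_attained\<close> and \<open>z_comp_attained\<close> below.
\<close>

definition lovasz_theta :: "'n::finite set set \<Rightarrow> real" where
  "lovasz_theta E = (GREATEST v. v \<in> (\<lambda>X. ones_matrix \<bullet> X) ` CTH2 E)"

definition z_comp_feasible :: "nat \<Rightarrow> 'n set set \<Rightarrow> (real ^ 'n ^ 'n::finite) set" where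
  "z_comp_feasible k E =
     {X \<in> CTH2 E. \<forall>I. card I = k \<longrightarrow> submatrix_on I X \<in> STAB2 I (induced_edges E I)}"

definition z_comp :: "nat \<Rightarrow> 'n::finite set set \<Rightarrow> real" where
  "z_comp k E = (GREATEST v. v \<in> (\<lambda>X. ones_matrix \<bullet> X) ` z_comp_feasible k E)"

text \<open>The constraint for the empty index set holds for every matrix.\<close>

lemma submatrix_on_empty_in_STAB2:
  "submatrix_on {} X \<in> STAB2 {} (induced_edges E {})"
proof -
  have "(0 :: real ^ 'a) \<in> stable_set_vectors {} (induced_edges E {})"
    by (simp add: stable_set_vectors_def)
  moreover have "submatrix_on {} X = outer_square 0"
    by (simp add: submatrix_on_def outer_square_def)
  ultimately show ?thesis
    unfolding STAB2_def by (simp add: hull_inc)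
qed

lemma CTH2_entry_le_1:
  assumes "X \<in> CTH2 E"
  shows "\<bar>X $ i $ j\<bar> \<le> 1"
proof -
  have sym: "X $ b $ a = X $ a $ b" for a b
    using assms unfolding CTH2_def symmetric_matrices_def transpose_def
    by (auto simp: vec_eq_iff)
  have q: "0 \<le> v \<bullet> (X *v v)" for v
    using assms by (simp add: CTH2_def psd_def)
  have e: "axis a 1 \<bullet> (X *v axis b (1::real)) = X $ a $ b" for a b
    by (simp add: inner_axis' matrix_vector_mul_component inner_axis)
  have d: "0 \<le> X $ a $ a" for a
    using q[of "axis a 1"] e by simp
  have "(\<Sum>a\<in>UNIV. X $ a $ a) = 1"
    using assms by (simp add: CTH2_def trace_def)
  then have d1: "X $ a $ a \<le> 1" for a
    using member_le_sum[of a UNIV "\<lambda>a. X $ a $ a"] d by auto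
  have "0 \<le> X $ i $ i + X $ j $ j + 2 * X $ i $ j"
    using q[of "axis i 1 + axis j 1"]
    by (simp add: matrix_vector_right_distrib inner_add_left inner_add_right e sym[of j i])
  moreover have "0 \<le> X $ i $ i + X $ j $ j - 2 * X $ i $ j"
    using q[of "axis i 1 - axis j 1"]
    by (simp add: matrix_vector_mult_diff_distrib inner_diff_left inner_diff_right e sym[of j i])
  ultimately show ?thesis
    using d1[of i] d1[of j] by linarith
qed

lemma compact_CTH2:
  fixes E :: "'a::finite set set"
  shows "compact (CTH2 E)"
proof -
  have "norm X \<le> (\<Sum>i\<in>(UNIV::'a set). \<Sum>j\<in>(UNIV::'a set). 1)" if "X \<in> CTH2 E" for X
  proof -
    have "norm X \<le> (\<Sum>i\<in>UNIV. norm (X $ i))"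
      unfolding norm_vec_def[of X] by (rule L2_set_le_sum) simp
    also have "\<dots> \<le> (\<Sum>i\<in>(UNIV::'a set). \<Sum>j\<in>(UNIV::'a set). 1)"
    proof (rule sum_mono)
      fix i :: 'a
      have "norm (X $ i) \<le> (\<Sum>j\<in>UNIV. \<bar>X $ i $ j\<bar>)"
        by (rule norm_le_l1_cart)
      also have "\<dots> \<le> (\<Sum>j\<in>(UNIV::'a set). 1)"
        by (intro sum_mono CTH2_entry_le_1[OF that])
      finally show "norm (X $ i) \<le> (\<Sum>j\<in>(UNIV::'a set). 1)" .
    qed
    finally show ?thesis .
  qed
  then have "bounded (CTH2 E)"
    by (auto simp: bounded_iff)
  moreover have "closed (CTH2 E)"
    unfolding CTH2_def psd_def symmetric_matrices_def trace_def transpose_def vec_eq_iff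
      matrix_vector_mult_def inner_vec_def mem_Collect_eq
    by (intro closed_Collect_conj closed_Collect_all closed_Collect_imp closed_Collect_eq
        closed_Collect_le continuous_intros) auto
  ultimately show ?thesis
    by (simp add: compact_eq_bounded_closed)
qed

lemma finite_stable_set_vectors: "finite (stable_set_vectors V E)"
proof (rule finite_subset)
  show "stable_set_vectors V E \<subseteq> range (\<lambda>S. \<chi> i. if i \<in> S then 1 else 0)"
  proof
    fix s assume "s \<in> stable_set_vectors V E"
    then have "s $ i = 0 \<or> s $ i = 1" for i
      by (cases "i \<in> V") (auto simp: stable_set_vectors_def)
    then have "s = (\<chi> i. if i \<in> {i. s $ i = 1} then 1 else 0)"
      by (auto simp: vec_eq_iff)
    then show "s \<in> range (\<lambda>S. \<chi> i. if i \<in> S then 1 else 0)"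
      by blast
  qed
qed simp

lemma compact_z_comp_feasible:
  fixes E :: "'a::finite set set"
  shows "compact (z_comp_feasible k E)"
proof -
  have STAB2: "closed (STAB2 I F)" for I :: "'a set" and F
    unfolding STAB2_def
    by (intro compact_imp_closed finite_imp_compact_convex_hull finite_imageI
        finite_stable_set_vectors)
  have if_cont: "continuous_on UNIV (\<lambda>X :: real ^ 'a ^ 'a. if P then X $ i $ j else 0)" for P i j
    by (cases P) (auto intro!: continuous_intros)
  have "continuous_on UNIV (submatrix_on I)" for I :: "'a set"
    unfolding submatrix_on_def by (intro continuous_on_vec_lambda if_cont)
  then have "closed (submatrix_on I -` STAB2 I F)" for I :: "'a set" and F
    using STAB2 by (simp add: closed_vimage)
  then have "closed (\<Inter>I\<in>{I. card I = k}. submatrix_on I -` STAB2 I (induced_edges E I))"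
    by (intro closed_INT) auto
  then have "compact (CTH2 E \<inter>
      (\<Inter>I\<in>{I. card I = k}. submatrix_on I -` STAB2 I (induced_edges E I)))"
    using compact_CTH2 by (rule compact_Int_closed[rotated])
  also have "CTH2 E \<inter> (\<Inter>I\<in>{I. card I = k}. submatrix_on I -` STAB2 I (induced_edges E I)) =
      z_comp_feasible k E"
    by (auto simp: z_comp_feasible_def)
  finally show ?thesis .
qed

lemma z_comp_feasible_nonempty:
  fixes E :: "'n::finite set set"
  assumes "simple_graph UNIV E"
  shows "z_comp_feasible k E \<noteq> {}"
proof -
  obtain a :: 'n where True by simp
  define u :: "real ^ 'n" where "u = axis a 1"
  define X where "X = outer_square u"
  have loop: "{i, j} \<in> E \<Longrightarrow> i \<noteq> j" for i j
    using assms by (force simp: simple_graph_def)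
  have "X \<in> symmetric_matrices"
    by (simp add: X_def outer_square_def symmetric_matrices_def transpose_def mult.commute)
  moreover have "trace X = 1"
    by (simp add: X_def outer_square_def trace_def u_def axis_def if_distrib cong: if_cong)
  moreover have "{i, j} \<in> E \<longrightarrow> X $ i $ j = 0" for i j
    using loop[of i j] by (auto simp: X_def outer_square_def u_def axis_def)
  moreover have "0 \<le> v \<bullet> (X *v v)" for v
  proof -
    have "X *v v = (u \<bullet> v) *\<^sub>R u"
      by (simp add: vec_eq_iff X_def outer_square_def matrix_vector_mult_def inner_vec_def
          sum_distrib_left sum_distrib_right ac_simps)
    then show ?thesis
      by (simp add: inner_commute)
  qed
  ultimately have CTH2: "X \<in> CTH2 E"
    by (simp add: CTH2_def psd_def)
  have "submatrix_on I X \<in> STAB2 I (induced_edges E I)" for I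
  proof -
    define s where "s = (\<chi> i. if i \<in> I then u $ i else 0)"
    have "s \<in> stable_set_vectors I (induced_edges E I)"
      using loop[of a a] by (auto simp: stable_set_vectors_def induced_edges_def s_def u_def axis_def)
    moreover have "submatrix_on I X = outer_square s"
      by (simp add: submatrix_on_def outer_square_def X_def s_def vec_eq_iff)
    ultimately show ?thesis
      unfolding STAB2_def by (simp add: hull_inc)
  qed
  with CTH2 show ?thesis
    by (auto simp: z_comp_feasible_def)
qed

lemma Greatest_linear_image:
  fixes C :: "real ^ 'n ^ 'n::finite" and S
  assumes "compact S" "S \<noteq> {}"
  defines "m \<equiv> (GREATEST v. v \<in> (\<lambda>X. C \<bullet> X) ` S)"
  shows "(\<exists>X\<in>S. C \<bullet> X = m) \<and> (\<forall>X\<in>S. C \<bullet> X \<le> m)"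
proof -
  have "continuous_on S (\<lambda>X. C \<bullet> X)"
    by (intro continuous_intros)
  then obtain X where X: "X \<in> S" "\<forall>Y\<in>S. C \<bullet> Y \<le> C \<bullet> X"
    using continuous_attains_sup[OF assms(1,2)] by blast
  then have "m = C \<bullet> X"
    unfolding m_def by (intro Greatest_equality) auto
  with X show ?thesis
    by auto
qed

lemma z_comp_attained:
  fixes E :: "'n::finite set set"
  assumes "simple_graph UNIV E"
  shows "(\<exists>X\<in>z_comp_feasible k E. ones_matrix \<bullet> X = z_comp k E) \<and>
         (\<forall>X\<in>z_comp_feasible k E. ones_matrix \<bullet> X \<le> z_comp k E)"
  unfolding z_comp_def
  by (intro Greatest_linear_image compact_z_comp_feasible z_comp_feasible_nonempty assms)

lemma lovasz_theta_attained:
  fixes E :: "'n::finite set set"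
  assumes "simple_graph UNIV E"
  shows "(\<exists>X\<in>CTH2 E. ones_matrix \<bullet> X = lovasz_theta E) \<and>
         (\<forall>X\<in>CTH2 E. ones_matrix \<bullet> X \<le> lovasz_theta E)"
  unfolding lovasz_theta_def
  using z_comp_feasible_nonempty[OF assms, of 0]
  by (intro Greatest_linear_image compact_CTH2) (auto simp: z_comp_feasible_def)

end

theory Submission
  imports Defs
begin

text \<open>
  All bounds come from comparing feasible sets. The constraint at level \<open>0\<close> is vacuous. The one at
  level \<open>1\<close> asks that every diagonal entry lie in \<open>[0, 1]\<close>, which positive semidefiniteness and
  \<open>trace X = 1\<close> already force; hence the first two levels both give the theta function. Restriction
  to a smaller index set is linear and sends squares of stable set vectors to squares of stable set
  vectors, so it maps \<open>STAB\<^sup>2(G\<^sub>J)\<close> into \<open>STAB\<^sup>2(G\<^sub>I)\<close> for \<open>I \<subseteq> J\<close>. As every set of \<open>j\<close> vertices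
  extends to one of \<open>k\<close> vertices when \<open>j \<le> k \<le> n\<close>, the feasible sets shrink as the level grows
  (\<open>z_comp_feasible_antimono\<close>).

  At level \<open>n\<close> the matrix itself lies in \<open>STAB\<^sup>2(G)\<close>. For the vector \<open>s\<close> of a stable set \<open>S\<close>, the
  square \<open>s s\<^sup>T\<close> has trace \<open>|S|\<close> and entry sum \<open>|S|\<^sup>2\<close>, so the linear inequality
  \<open>\<langle>\<one>, X\<rangle> \<le> \<alpha>(G) trace X\<close> holds at all generators and thus on the whole polytope; with
  \<open>trace X = 1\<close> this bounds the last level by \<open>\<alpha>(G)\<close>. Equality is attained at
  \<open>s s\<^sup>T / |S|\<close> for a maximum stable set \<open>S\<close>, which is a convex combination of \<open>s s\<^sup>T\<close> and the
  square of the zero vector.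
\<close>

section \<open>Stable sets and their vectors\<close>

definition indicator_vector :: "'n set \<Rightarrow> real ^ 'n::finite" where
  "indicator_vector S = (\<chi> i. if i \<in> S then 1 else 0)"

lemma simple_graph_no_loop:
  assumes "simple_graph V E" "{i, j} \<in> E"
  shows "i \<noteq> j"
  using assms by (force simp: simple_graph_def)

lemma stable_set_vectorE:
  assumes "s \<in> stable_set_vectors V E"
  obtains S where "S \<in> stable_sets V E" "s = indicator_vector S"
proof
  have zero_one: "s $ i = 0 \<or> s $ i = 1" for i
    using assms by (cases "i \<in> V") (auto simp: stable_set_vectors_def)
  then show "s = indicator_vector {i. s $ i = 1}"
    by (auto simp: indicator_vector_def vec_eq_iff)
  show "{i. s $ i = 1} \<in> stable_sets V E"
    using assms by (force simp: stable_set_vectors_def stable_sets_def pairwise_def)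
qed

lemma indicator_vector_in_stable_set_vectors:
  assumes "simple_graph V E" "S \<in> stable_sets V E"
  shows "indicator_vector S \<in> stable_set_vectors V E"
  using assms(2) simple_graph_no_loop[OF assms(1)]
  by (fastforce simp: stable_set_vectors_def stable_sets_def indicator_vector_def pairwise_def)

lemma card_stable_set_le:
  fixes E :: "'n::finite set set"
  assumes "S \<in> stable_sets V E"
  shows "card S \<le> stability_number V E"
  unfolding stability_number_def using assms by (intro Max_ge) auto

lemma maximum_stable_setE:
  fixes E :: "'n::finite set set"
  obtains S where "S \<in> stable_sets V E" "card S = stability_number V E"
proof -
  have "{} \<in> stable_sets V E"
    by (simp add: stable_sets_def)
  then have "stability_number V E \<in> card ` stable_sets V E"
    unfolding stability_number_def by (intro Max_in) auto
  then show ?thesis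
    using that by auto
qed

lemma stability_number_pos:
  fixes E :: "'n::finite set set"
  shows "0 < stability_number (UNIV :: 'n set) E"
proof -
  obtain a :: 'n where True by simp
  have "{a} \<in> stable_sets UNIV E"
    by (simp add: stable_sets_def)
  then show ?thesis
    using card_stable_set_le[of "{a}" UNIV E] by simp
qed

section \<open>Squares of vectors\<close>

lemma trace_scaleR: "trace (c *\<^sub>R X) = c * trace (X :: real ^ 'n ^ 'n::finite)"
  by (simp add: trace_def sum_distrib_left)

lemma trace_outer_square_indicator:
  "trace (outer_square (indicator_vector S)) = real (card (S :: 'n::finite set))"
  by (simp add: trace_def outer_square_def indicator_vector_def if_distrib sum.If_cases cong: if_cong)

lemma ones_inner_outer_square_indicator:
  "ones_matrix \<bullet> outer_square (indicator_vector S) = (real (card (S :: 'n::finite set)))\<^sup>2"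
proof -
  have "ones_matrix \<bullet> outer_square s = (\<Sum>i\<in>UNIV. s $ i)\<^sup>2" for s :: "real ^ 'n"
    by (simp add: inner_vec_def ones_matrix_def outer_square_def power2_eq_square sum_product)
  then show ?thesis
    by (simp add: indicator_vector_def sum.If_cases)
qed

lemma psd_outer_square: "psd (outer_square s)"
proof -
  have "outer_square s *v v = (s \<bullet> v) *\<^sub>R s" for v
    by (simp add: vec_eq_iff outer_square_def matrix_vector_mult_def inner_vec_def
        sum_distrib_left sum_distrib_right ac_simps)
  then have "0 \<le> v \<bullet> (outer_square s *v v)" for v
    by (simp add: inner_commute)
  moreover have "outer_square s \<in> symmetric_matrices"
    by (simp add: symmetric_matrices_def transpose_def outer_square_def vec_eq_iff mult.commute)
  ultimately show ?thesis
    by (simp add: psd_def)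
qed

lemma psd_scaleR:
  assumes "psd X" "0 \<le> c"
  shows "psd (c *\<^sub>R X)"
  using assms
  by (simp add: psd_def symmetric_matrices_def transpose_def vec_eq_iff
      scaleR_matrix_vector_assoc[symmetric])

lemma psd_diagonal_nonneg:
  assumes "psd X"
  shows "0 \<le> X $ i $ i"
proof -
  have "0 \<le> axis i 1 \<bullet> (X *v axis i 1)"
    using assms by (simp add: psd_def)
  then show ?thesis
    by (simp add: inner_axis' matrix_vector_mul_component inner_axis)
qed

text \<open>The zero vector is the vector of the empty stable set, so the polytope is star-shaped about \<open>0\<close>.\<close>

lemma scaled_outer_square_in_STAB2:
  assumes "s \<in> stable_set_vectors V E" "0 \<le> c" "c \<le> 1"
  shows "c *\<^sub>R outer_square s \<in> STAB2 V E"
proof -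
  have "(0 :: real ^ 'a) \<in> stable_set_vectors V E"
    by (simp add: stable_set_vectors_def)
  moreover have "outer_square (0 :: real ^ 'a) = 0"
    by (simp add: outer_square_def vec_eq_iff)
  ultimately have "0 \<in> STAB2 V E"
    unfolding STAB2_def by (metis hull_inc imageI)
  moreover have "outer_square s \<in> STAB2 V E"
    unfolding STAB2_def using assms(1) by (simp add: hull_inc)
  moreover have "convex (STAB2 V E)"
    unfolding STAB2_def by (rule convex_convex_hull)
  ultimately have "(1 - c) *\<^sub>R 0 + c *\<^sub>R outer_square s \<in> STAB2 V E"
    using assms(2,3) by (intro convexD) auto
  then show ?thesis
    by simp
qed

section \<open>Monotonicity of the hierarchy\<close>

lemma linear_submatrix_on: "linear (submatrix_on I)"
  by (rule linearI) (simp_all add: submatrix_on_def vec_eq_iff)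

text \<open>A linear map commutes with convex hulls, so the claim reduces to the generators.\<close>

lemma submatrix_on_STAB2:
  assumes "I \<subseteq> J" "X \<in> STAB2 J (induced_edges E J)"
  shows "submatrix_on I X \<in> STAB2 I (induced_edges E I)"
proof -
  have "submatrix_on I (outer_square s) \<in> outer_square ` stable_set_vectors I (induced_edges E I)"
    if s: "s \<in> stable_set_vectors J (induced_edges E J)" for s
  proof -
    define t where "t = (\<chi> i. if i \<in> I then s $ i else 0)"
    have "t \<in> stable_set_vectors I (induced_edges E I)"
      using s assms(1) by (fastforce simp: stable_set_vectors_def induced_edges_def t_def)
    moreover have "submatrix_on I (outer_square s) = outer_square t"
      by (simp add: submatrix_on_def outer_square_def t_def vec_eq_iff)
    ultimately show ?thesis
      by blast
  qed
  then have "convex hull (submatrix_on I ` outer_square ` stable_set_vectors J (induced_edges E J))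
      \<subseteq> STAB2 I (induced_edges E I)"
    unfolding STAB2_def by (intro hull_mono) blast
  then have "submatrix_on I ` STAB2 J (induced_edges E J) \<subseteq> STAB2 I (induced_edges E I)"
    by (simp add: STAB2_def convex_hull_linear_image[OF linear_submatrix_on])
  with assms(2) show ?thesis
    by blast
qed

lemma z_comp_feasible_antimono:
  fixes E :: "'n::finite set set"
  assumes "j \<le> k" "k \<le> CARD('n)"
  shows "z_comp_feasible k E \<subseteq> z_comp_feasible j E"
proof
  fix X assume X: "X \<in> z_comp_feasible k E"
  have "submatrix_on I X \<in> STAB2 I (induced_edges E I)" if I: "card I = j" for I
  proof -
    obtain J where J: "I \<subseteq> J" "card J = k"
      using exists_subset_between[of I k UNIV] I assms by auto
    have "submatrix_on I (submatrix_on J X) \<in> STAB2 I (induced_edges E I)"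
      using X J by (intro submatrix_on_STAB2[OF J(1)]) (simp add: z_comp_feasible_def)
    moreover have "submatrix_on I (submatrix_on J X) = submatrix_on I X"
      using J(1) by (auto simp: submatrix_on_def vec_eq_iff)
    ultimately show ?thesis
      by simp
  qed
  with X show "X \<in> z_comp_feasible j E"
    by (simp add: z_comp_feasible_def)
qed

lemma z_comp_antimono:
  fixes E :: "'n::finite set set"
  assumes "simple_graph (UNIV :: 'n set) E" "j \<le> k" "k \<le> CARD('n)"
  shows "z_comp k E \<le> z_comp j E"
  using z_comp_attained[OF assms(1), of k] z_comp_attained[OF assms(1), of j]
    z_comp_feasible_antimono[OF assms(2,3), of E]
  by (metis subsetD)

section \<open>The first two levels\<close>

lemma z_comp_feasible_0: "z_comp_feasible 0 E = CTH2 (E :: 'n::finite set set)"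
  by (auto simp: z_comp_feasible_def submatrix_on_empty_in_STAB2)

text \<open>
  The polytope of a single vertex \<open>i\<close> is the segment from \<open>0\<close> to the matrix unit at \<open>(i, i)\<close>.
\<close>

lemma z_comp_feasible_1:
  fixes E :: "'n::finite set set"
  assumes "simple_graph UNIV E"
  shows "z_comp_feasible 1 E = CTH2 E"
proof
  show "CTH2 E \<subseteq> z_comp_feasible 1 E"
  proof
    fix X assume X: "X \<in> CTH2 E"
    have "submatrix_on {i} X \<in> STAB2 {i} (induced_edges E {i})" for i
    proof -
      have "indicator_vector {i} \<in> stable_set_vectors {i} (induced_edges E {i})"
        using assms
        by (intro indicator_vector_in_stable_set_vectors)
          (auto simp: simple_graph_def induced_edges_def stable_sets_def)
      moreover have "0 \<le> X $ i $ i" "X $ i $ i \<le> 1"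
        using X psd_diagonal_nonneg[of X i] CTH2_entry_le_1[OF X, of i i]
        by (auto simp: CTH2_def)
      ultimately have
        "(X $ i $ i) *\<^sub>R outer_square (indicator_vector {i}) \<in> STAB2 {i} (induced_edges E {i})"
        by (rule scaled_outer_square_in_STAB2)
      moreover have "submatrix_on {i} X = (X $ i $ i) *\<^sub>R outer_square (indicator_vector {i})"
        by (auto simp: submatrix_on_def outer_square_def indicator_vector_def vec_eq_iff)
      ultimately show ?thesis
        by simp
    qed
    with X show "X \<in> z_comp_feasible 1 E"
      by (auto simp: z_comp_feasible_def card_1_singleton_iff)
  qed
qed (auto simp: z_comp_feasible_def)

section \<open>The last level\<close>

lemma z_comp_feasible_CARD:
  fixes E :: "'n::finite set set"
  shows "z_comp_feasible CARD('n) E = CTH2 E \<inter> STAB2 UNIV E"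
proof -
  have "card I = CARD('n) \<longleftrightarrow> I = UNIV" for I :: "'n set"
    using card_subset_eq[of UNIV I] by auto
  moreover have "submatrix_on UNIV X = X" for X :: "real ^ 'n ^ 'n"
    by (simp add: submatrix_on_def vec_eq_iff)
  moreover have "induced_edges E UNIV = E"
    by (simp add: induced_edges_def)
  ultimately show ?thesis
    by (auto simp: z_comp_feasible_def)
qed

text \<open>
  Both sides are linear in the matrix, so only the generators matter, where the inequality reads
  \<open>|S|\<^sup>2 \<le> \<alpha>(G) |S|\<close>.
\<close>

lemma STAB2_ones_inner_le_trace:
  fixes X :: "real ^ 'a ^ 'a::finite"
  assumes "X \<in> STAB2 V E"
  shows "ones_matrix \<bullet> X \<le> real (stability_number V E) * trace X"
proof -
  let ?H = "{X :: real ^ 'a ^ 'a. ones_matrix \<bullet> X \<le> real (stability_number V E) * trace X}"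
  have "linear (\<lambda>X :: real ^ 'a ^ 'a. ones_matrix \<bullet> X - real (stability_number V E) * trace X)"
    by (rule linearI) (simp_all add: inner_add_right trace_add trace_scaleR algebra_simps)
  then have "convex ((\<lambda>X :: real ^ 'a ^ 'a. ones_matrix \<bullet> X - real (stability_number V E) * trace X)
      -` {..0})"
    by (intro convex_linear_vimage) auto
  then have "convex ?H"
    by (simp add: vimage_def)
  moreover have "outer_square ` stable_set_vectors V E \<subseteq> ?H"
  proof clarify
    fix s assume "s \<in> stable_set_vectors V E"
    then obtain S where S: "S \<in> stable_sets V E" "s = indicator_vector S"
      by (rule stable_set_vectorE)
    show "ones_matrix \<bullet> outer_square s \<le> real (stability_number V E) * trace (outer_square s)"
      using card_stable_set_le[OF S(1)]
      by (simp add: S(2) trace_outer_square_indicator ones_inner_outer_square_indicator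
          power2_eq_square mult_right_mono)
  qed
  ultimately have "STAB2 V E \<subseteq> ?H"
    unfolding STAB2_def by (intro hull_minimal)
  with assms show ?thesis
    by blast
qed

lemma normalized_stable_set_square_feasible:
  fixes E :: "'n::finite set set"
  assumes "simple_graph UNIV E" "S \<in> stable_sets UNIV E" "S \<noteq> {}"
  shows "(1 / real (card S)) *\<^sub>R outer_square (indicator_vector S) \<in> z_comp_feasible CARD('n) E"
proof -
  let ?s = "indicator_vector S"
  let ?X = "(1 / real (card S)) *\<^sub>R outer_square ?s"
  have s: "?s \<in> stable_set_vectors UNIV E"
    using assms(1,2) by (rule indicator_vector_in_stable_set_vectors)
  have card: "0 < card S"
    using assms(3) by (simp add: card_gt_0_iff)
  have "psd ?X"
    by (intro psd_scaleR psd_outer_square) simp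
  moreover have "trace ?X = 1"
    using assms(3) by (simp add: trace_scaleR trace_outer_square_indicator)
  moreover have "{i, j} \<in> E \<longrightarrow> ?X $ i $ j = 0" for i j
    using s by (auto simp: stable_set_vectors_def outer_square_def)
  ultimately have "?X \<in> CTH2 E"
    by (simp add: CTH2_def psd_def)
  moreover have "?X \<in> STAB2 UNIV E"
    using card by (intro scaled_outer_square_in_STAB2 s) auto
  ultimately show ?thesis
    by (simp add: z_comp_feasible_CARD)
qed

lemma z_comp_CARD:
  fixes E :: "'n::finite set set"
  assumes "simple_graph (UNIV :: 'n set) E"
  shows "z_comp CARD('n) E = real (stability_number (UNIV :: 'n set) E)"
proof (rule antisym)
  obtain X where X: "X \<in> z_comp_feasible CARD('n) E" "ones_matrix \<bullet> X = z_comp CARD('n) E"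
    using z_comp_attained[OF assms] by blast
  then have "X \<in> STAB2 UNIV E" "trace X = 1"
    by (auto simp: z_comp_feasible_CARD CTH2_def)
  then show "z_comp CARD('n) E \<le> real (stability_number (UNIV :: 'n set) E)"
    using STAB2_ones_inner_le_trace[of X UNIV E] X(2) by simp
next
  obtain S where S: "S \<in> stable_sets (UNIV :: 'n set) E" "card S = stability_number UNIV E"
    by (rule maximum_stable_setE)
  let ?X = "(1 / real (card S)) *\<^sub>R outer_square (indicator_vector S)"
  have "0 < card S"
    using S(2) stability_number_pos[of E] by simp
  then have "S \<noteq> {}"
    by (simp add: card_gt_0_iff)
  have "ones_matrix \<bullet> ?X = real (card S)"
    using \<open>0 < card S\<close> by (simp add: ones_inner_outer_square_indicator power2_eq_square)
  moreover have "?X \<in> z_comp_feasible CARD('n) E"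
    using assms S(1) \<open>S \<noteq> {}\<close> by (rule normalized_stable_set_square_feasible)
  ultimately show "real (stability_number (UNIV :: 'n set) E) \<le> z_comp CARD('n) E"
    using z_comp_attained[OF assms, of "CARD('n)"] S(2) by metis
qed

section \<open>The chain of bounds\<close>

theorem lemma5:
  fixes E :: "'n::finite set set" and k :: nat
  assumes "simple_graph (UNIV :: 'n set) E"
    and "k \<in> {1..CARD('n)}"
  shows "lovasz_theta E = z_comp 0 E \<and>
         z_comp 0 E = z_comp 1 E \<and>
         z_comp 1 E \<ge> z_comp (k - 1) E \<and>
         z_comp (k - 1) E \<ge> z_comp k E \<and>
         z_comp k E \<ge> z_comp CARD('n) E \<and>
         z_comp CARD('n) E = real (stability_number (UNIV :: 'n set) E)"
proof (intro conjI)
  show "lovasz_theta E = z_comp 0 E"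
    by (simp add: lovasz_theta_def z_comp_def z_comp_feasible_0)
  show level_0_1: "z_comp 0 E = z_comp 1 E"
    unfolding z_comp_def z_comp_feasible_0 z_comp_feasible_1[OF assms(1)] ..
  \<comment> \<open>Comparing with level \<open>0\<close> rather than \<open>1\<close> covers \<open>k = 1\<close>, where \<open>k - 1 < 1\<close>.\<close>
  show "z_comp (k - 1) E \<le> z_comp 1 E"
    unfolding level_0_1[symmetric] using assms by (intro z_comp_antimono) auto
  show "z_comp k E \<le> z_comp (k - 1) E"
    using assms by (intro z_comp_antimono) auto
  show "z_comp CARD('n) E \<le> z_comp k E"
    using assms by (intro z_comp_antimono) auto
  show "z_comp CARD('n) E = real (stability_number (UNIV :: 'n set) E)"
    using assms(1) by (rule z_comp_CARD)
qed

end
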